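(* For any nonnegative integer $n$, $F_1(n)$ equals the number of partitions of $n-1$ in two colors (red and blue), with optional overlines, in which: the odd parts and the parts $\equiv 0 \pmod{16}$ may appear only in blue color; the parts $\equiv 2,14 \pmod{16}$ may appear in red and in blue, with the first blue occurrence of each such part optionally overlined; and all other even parts may appear in either color (with no overlines on any parts other than those just described).
   Context: A two-color partition of $n$ is a finite multiset of positive integers (parts), each part colored red or blue, whose sum is $n$ (the same integer in two different colors counts as two different kinds of parts; repetitions are allowed). There are no partitions of $-1$. For a nonnegative integer $n$, $\mathcal{F}(n)$ is the set of two-color partitions of $n$ in which even parts may occur only in blue color (odd parts may occur in either color). $F_1(n)$ is the number of partitions in $\mathcal{F}(n)$ in which the number of red odd parts (counted with multiplicity) is odd. "The first blue occurrence of a part is optionally overlined" means that, for each part size $m$ of the indicated type that occurs in blue, there are two distinct choices: either exactly one of the blue copies of $m$ is overlined (the first one), or none is. *)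

theory Defs
  imports Complex_Main "HOL-Library.Multiset"
begin

datatype color = Red | Blue

text \<open>A part is its size together with its color. The weight is an integer so that the (empty) set
  of partitions of \<open>-1\<close> makes sense.\<close>

definition two_color_partitions :: "int \<Rightarrow> (nat \<times> color) multiset set" where
  "two_color_partitions k =
     {P. (\<forall>(m, c) \<in># P. 0 < m) \<and> int (\<Sum>(m, c) \<in># P. m) = k}"

definition calF :: "nat \<Rightarrow> (nat \<times> color) multiset set" where
  "calF n = {P \<in> two_color_partitions (int n). \<forall>(m, c) \<in># P. even m \<longrightarrow> c = Blue}"

definition F1 :: "nat \<Rightarrow> nat" where
  "F1 n = card {P \<in> calF n. odd (size {#(m, c) \<in># P. odd m \<and> c = Red#})}"

text \<open>In an overlined partition each copy of a part carries a third component that tells whether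
  this copy is overlined. The copies of one part are interchangeable in a multiset, so overlining
  (at most) the first blue copy means that at most one copy of that size is overlined.\<close>

definition overlined_two_color_partitions ::
    "(nat \<Rightarrow> bool) \<Rightarrow> int \<Rightarrow> (nat \<times> color \<times> bool) multiset set" where
  "overlined_two_color_partitions ov k =
     {P. image_mset (\<lambda>(m, c, b). (m, c)) P \<in> two_color_partitions k \<and>
         (\<forall>(m, c, b) \<in># P. b \<longrightarrow> c = Blue \<and> ov m) \<and>
         (\<forall>m. count P (m, Blue, True) \<le> 1)}"

definition restricted_overlined_partitions :: "int \<Rightarrow> (nat \<times> color \<times> bool) multiset set" where
  "restricted_overlined_partitions k =
     {P \<in> overlined_two_color_partitions (\<lambda>m. m mod 16 = 2 \<or> m mod 16 = 14) k.
        \<forall>(m, c, b) \<in># P. odd m \<or> m mod 16 = 0 \<longrightarrow> c = Blue}"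

end

theory Submission
  imports Defs "HOL-Computational_Algebra.Formal_Power_Series"
begin

text \<open>The proof compares generating functions in a variable \<open>q\<close>. Give every red odd part the weight
  \<open>s\<close>; then the partitions in \<open>calF n\<close> are generated by the product of \<open>1 / (1 - q^m)\<close> over all
  \<open>m\<close> times the product of \<open>1 / (1 - s q^m)\<close> over odd \<open>m\<close>. Taking \<open>s = 1\<close> minus \<open>s = -1\<close>
  annihilates the partitions with an even number of red odd parts and counts the others twice.
  With \<open>f(q)\<close> for the product of \<open>1 + q^m\<close> over odd \<open>m\<close>, everything hinges on
  \<open>1 / f(-q) - 1 / f(q) = (f(q) - f(-q)) / (f(q) f(-q))\<close>, where \<open>f(q) f(-q)\<close> is the product of
  \<open>1 - q^m\<close> over \<open>m \<equiv> 2 (mod 4)\<close>.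

  The numerator is found with two instances of the Jacobi triple product. The first, with factors
  sorted modulo 4, says that \<open>f(q)\<close> times the product of all \<open>1 - q^(4i)\<close> is the sum of
  \<open>q^(2 j^2 + j)\<close> over all integers \<open>j\<close>. In \<open>f(q) - f(-q)\<close> only odd \<open>j\<close> survive, and \<open>j = 2i - 1\<close>
  turns the exponent into \<open>8 i^2 - 6 i + 1\<close>. The sum of \<open>q^(8 i^2 - 6 i)\<close> is again a triple product,
  this time modulo 16: the product of \<open>1 + q^m\<close> over \<open>m \<equiv> 2, 14\<close> and of \<open>1 - q^m\<close> over \<open>m \<equiv> 0\<close>.
  The factor \<open>q\<close> left over is the shift from \<open>n\<close> to \<open>n - 1\<close>; the factors \<open>1 + q^m\<close> generate
  the overlined parts; and the factors \<open>1 - q^m\<close> with \<open>16 dvd m\<close> cancel the red multiples of 16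
  among the even parts in the denominator. See \<open>odd_part_product_identity\<close>.

  Infinite products are avoided: a coefficient is unaffected by large parts, so all products are
  finite, over parts up to a large multiple of 16, and identities are stated for the coefficients
  below a bound (\<open>agree_below\<close>). The triple product has an exact finite form
  (\<open>finite_triple_product\<close>), from which its truncated form follows.\<close>

section \<open>A finite form of the Jacobi triple product\<close>

text \<open>The Gaussian binomial coefficient with base \<open>p\<close>, defined by a Pascal rule so that it makes sense
  in every commutative semiring, without division.\<close>

fun gauss_binomial :: "'a::comm_semiring_1 \<Rightarrow> nat \<Rightarrow> nat \<Rightarrow> 'a" where
  "gauss_binomial p n 0 = 1"
| "gauss_binomial p 0 (Suc k) = 0"
| "gauss_binomial p (Suc n) (Suc k) =
     gauss_binomial p n (Suc k) + p ^ (n - k) * gauss_binomial p n k"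

lemma gauss_binomial_eq_0: "n < k \<Longrightarrow> gauss_binomial p n k = 0"
proof (induction n arbitrary: k)
  case 0
  then show ?case by (cases k) auto
next
  case (Suc n)
  then show ?case by (cases k) auto
qed

text \<open>The mirror image of the defining Pascal rule. The triple product has two kinds of factors; adding
  a factor of the first kind calls for the defining rule, adding one of the second kind for this one.\<close>

lemma gauss_binomial_Suc_Suc_alt:
  "gauss_binomial p (Suc n) (Suc k) =
     p ^ Suc k * gauss_binomial p n (Suc k) + gauss_binomial p n k"
proof (induction n arbitrary: k)
  case 0
  then show ?case by (cases k) auto
next
  case (Suc n)
  show ?case
  proof (cases k)
    case 0
    have "gauss_binomial p (Suc (Suc n)) (Suc 0) = gauss_binomial p (Suc n) (Suc 0) + p ^ Suc n"
      by simp
    also have "gauss_binomial p (Suc n) (Suc 0) = p * gauss_binomial p n (Suc 0) + 1"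
      using Suc.IH[of 0] by simp
    also have "p * gauss_binomial p n (Suc 0) + 1 + p ^ Suc n = p * gauss_binomial p (Suc n) (Suc 0) + 1"
      by (simp add: algebra_simps)
    finally show ?thesis using 0 by simp
  next
    case k: (Suc l)
    show ?thesis
    proof (cases "k \<le> n")
      case True
      then have e: "p ^ (n - l) * (p ^ k * g) = p ^ Suc n * g"
        "p ^ Suc k * (p ^ (n - k) * g) = p ^ Suc n * g" for g
        using k by (simp_all only: mult.assoc[symmetric] power_add[symmetric]) simp_all
      have "gauss_binomial p (Suc (Suc n)) (Suc k) =
          (p ^ Suc k * gauss_binomial p n (Suc k) + gauss_binomial p n k)
          + p ^ (n - l) * (p ^ k * gauss_binomial p n k + gauss_binomial p n l)"
        using Suc.IH[of k] Suc.IH[of l] k by (simp del: gauss_binomial.simps(3) add: gauss_binomial.simps(3)[of p "Suc n"])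
      also have "\<dots> = p ^ Suc k * (gauss_binomial p n (Suc k) + p ^ (n - k) * gauss_binomial p n k)
          + (gauss_binomial p n (Suc l) + p ^ (n - l) * gauss_binomial p n l)"
        unfolding distrib_left e k[symmetric] by (simp only: add_ac)
      finally show ?thesis using k by simp
    next
      case False
      then show ?thesis
        using Suc.IH[of l] k by (auto simp: gauss_binomial_eq_0)
    qed
  qed
qed

definition q_factorial :: "'a::comm_ring_1 \<Rightarrow> nat \<Rightarrow> 'a" where
  "q_factorial p n = (\<Prod>i<n. 1 - p ^ Suc i)"

lemma q_factorial_Suc: "q_factorial p (Suc n) = q_factorial p n * (1 - p ^ Suc n)"
  by (simp add: q_factorial_def)

text \<open>The division-free form of the quotient formula for Gaussian binomials.\<close>

lemma gauss_binomial_mult_q_factorial: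
  "gauss_binomial p (m + k) k * (q_factorial p m * q_factorial p k) = q_factorial p (m + k)"
proof (induction "m + k" arbitrary: m k)
  case 0
  then show ?case by (simp add: q_factorial_def)
next
  case (Suc s)
  show ?case
  proof (cases k)
    case 0
    then show ?thesis by (simp add: q_factorial_def)
  next
    case k: (Suc l)
    show ?thesis
    proof (cases m)
      case 0
      have "gauss_binomial p k k = 1" for k by (induction k) (auto simp: gauss_binomial_eq_0)
      then show ?thesis using 0 by (simp add: q_factorial_def)
    next
      case m: (Suc r)
      have 1: "gauss_binomial p (r + k) k * (q_factorial p r * q_factorial p k) = q_factorial p (r + k)"
        using Suc.hyps m by auto
      have 2: "gauss_binomial p (m + l) l * (q_factorial p m * q_factorial p l) = q_factorial p (m + l)"
        using Suc.hyps k by auto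
      have "gauss_binomial p (m + k) k = gauss_binomial p (r + k) k + p ^ m * gauss_binomial p (m + l) l"
        using m k by simp
      then have "gauss_binomial p (m + k) k * (q_factorial p m * q_factorial p k)
        = (1 - p ^ m) * (gauss_binomial p (r + k) k * (q_factorial p r * q_factorial p k))
        + p ^ m * (1 - p ^ k) * (gauss_binomial p (m + l) l * (q_factorial p m * q_factorial p l))"
        using m k by (simp only: q_factorial_Suc) (simp add: algebra_simps)
      also have "\<dots> = q_factorial p (m + l) * (1 - p ^ (m + k))"
        unfolding 1 2 using m k by (simp add: algebra_simps power_add)
      also have "\<dots> = q_factorial p (m + k)"
        using k by (simp add: q_factorial_Suc)
      finally show ?thesis .
    qed
  qed
qed

definition triangle :: "int \<Rightarrow> nat" where
  "triangle j = nat (j * (j + 1) div 2)"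

lemma int_triangle: "2 * int (triangle j) = j * (j + 1)"
proof -
  have "0 \<le> j * (j + 1)"
    by (cases "j \<ge> 0") (auto intro: mult_nonpos_nonpos)
  moreover have "even (j * (j + 1))" by simp
  ultimately show ?thesis by (simp add: triangle_def)
qed

text \<open>The summand of the triple product. In the usual notation with \<open>x = z q\<close> and \<open>y = q / z\<close> it is
  \<open>z^j q^(j^2)\<close>; two variables keep all exponents natural, also for negative \<open>j\<close>.\<close>

definition theta_term :: "'a::comm_semiring_1 \<Rightarrow> 'a \<Rightarrow> int \<Rightarrow> 'a" where
  "theta_term x y j = x ^ triangle j * y ^ triangle (j - 1)"

text \<open>Multiplication by the new factor \<open>x^(m+1) y^m\<close> shifts the index of the summand, up to exactly
  the power of \<open>x y\<close> that appears in the Pascal rule. The next lemma does the same in the other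
  direction.\<close>

lemma theta_term_raise:
  assumes "int k \<le> int m + int n"
  shows "(x * y) ^ (m + n - k) * theta_term x y (int k - int n + 1)
    = x ^ Suc m * y ^ m * theta_term x y (int k - int n)"
proof -
  (* Twice a triangular number is a polynomial, so the exponents are compared after doubling. *)
  have "2 * int (m + n - k + triangle (int k - int n + 1)) = 2 * int (Suc m + triangle (int k - int n))"
    "2 * int (m + n - k + triangle (int k - int n)) = 2 * int (m + triangle (int k - int n - 1))"
    using assms by (simp_all add: distrib_left int_triangle of_nat_diff algebra_simps)
  then have 1: "m + n - k + triangle (int k - int n + 1) = Suc m + triangle (int k - int n)"
    "m + n - k + triangle (int k - int n) = m + triangle (int k - int n - 1)"
    by (simp_all only: mult_cancel_left of_nat_eq_iff) simp_all
  have "(x * y) ^ (m + n - k) * theta_term x y (int k - int n + 1) = x ^ (m + n - k + triangle (int k - int n + 1)) * y ^ (m + n - k + triangle (int k - int n))"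
    by (simp only: theta_term_def power_add power_mult_distrib) (simp add: mult_ac)
  also have "\<dots> = x ^ Suc m * y ^ m * theta_term x y (int k - int n)"
    unfolding 1 by (simp only: theta_term_def power_add) (simp add: mult_ac)
  finally show ?thesis .
qed

lemma theta_term_lower:
  "(x * y) ^ k * theta_term x y (int k - int n - 1)
    = x ^ n * y ^ Suc n * theta_term x y (int k - int n)"
proof -
  have "2 * int (k + triangle (int k - int n - 1)) = 2 * int (n + triangle (int k - int n))"
    "2 * int (k + triangle (int k - int n - 1 - 1)) = 2 * int (Suc n + triangle (int k - int n - 1))"
    by (simp_all add: distrib_left int_triangle algebra_simps)
  then have 1: "k + triangle (int k - int n - 1) = n + triangle (int k - int n)"
    "k + triangle (int k - int n - 1 - 1) = Suc n + triangle (int k - int n - 1)"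
    by (simp_all only: mult_cancel_left of_nat_eq_iff) simp_all
  have "(x * y) ^ k * theta_term x y (int k - int n - 1) = x ^ (k + triangle (int k - int n - 1)) * y ^ (k + triangle (int k - int n - 1 - 1))"
    by (simp only: theta_term_def power_add power_mult_distrib) (simp add: mult_ac)
  also have "\<dots> = x ^ n * y ^ Suc n * theta_term x y (int k - int n)"
    unfolding 1 by (simp only: theta_term_def power_add) (simp add: mult_ac)
  finally show ?thesis .
qed

text \<open>By induction on the number of factors of either kind. The step is the one of the binomial theorem:
  the Pascal rule splits the new sum into two, one of which is shifted by one index.\<close>

theorem finite_triple_product:
  fixes x y :: "'a::comm_semiring_1"
  shows "(\<Prod>i<m. 1 + x ^ Suc i * y ^ i) * (\<Prod>i<n. 1 + x ^ i * y ^ Suc i)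
    = (\<Sum>k\<le>m + n. gauss_binomial (x * y) (m + n) k * theta_term x y (int k - int n))"
proof (induction n)
  case 0
  show ?case
  proof (induction m)
    case 0
    show ?case by (simp add: theta_term_def triangle_def)
  next
    case (Suc m)
    let ?T = "\<lambda>k. theta_term x y (int k)" and ?g = "gauss_binomial (x * y)"
    have "(\<Sum>k\<le>Suc m. ?g (Suc m) k * ?T k)
      = ?T 0 + (\<Sum>k\<le>m. ?g (Suc m) (Suc k) * ?T (Suc k))"
      by (simp add: sum.atMost_Suc_shift del: sum.atMost_Suc gauss_binomial.simps(3))
    also have "\<dots> = (?T 0 + (\<Sum>k\<le>m. ?g m (Suc k) * ?T (Suc k)))
        + (\<Sum>k\<le>m. (x * y) ^ (m - k) * ?T (Suc k) * ?g m k)"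
      by (simp add: algebra_simps sum.distrib)
    also have "?T 0 + (\<Sum>k\<le>m. ?g m (Suc k) * ?T (Suc k)) = (\<Sum>k\<le>Suc m. ?g m k * ?T k)"
      by (simp add: sum.atMost_Suc_shift del: sum.atMost_Suc)
    also have "\<dots> = (\<Sum>k\<le>m. ?g m k * ?T k)"
      by (simp add: gauss_binomial_eq_0)
    also have "(\<Sum>k\<le>m. (x * y) ^ (m - k) * ?T (Suc k) * ?g m k)
      = (\<Sum>k\<le>m. x ^ Suc m * y ^ m * (?g m k * ?T k))"
      using theta_term_raise[of _ m 0 x y]
      by (intro sum.cong) (auto simp: algebra_simps)
    finally show ?case
      using Suc.IH by (simp add: algebra_simps flip: sum_distrib_left)
  qed
next
  case (Suc n)
  let ?T = "\<lambda>k. theta_term x y (int k - int n)" and ?g = "gauss_binomial (x * y)"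
  let ?U = "\<lambda>k. theta_term x y (int k - int n - 1)"
  define L where "L = m + n"
  have T: "?U (Suc k) = ?T k" for k by simp
  have "(\<Sum>k\<le>Suc L. ?g (Suc L) k * ?U k)
    = ?U 0 + (\<Sum>k\<le>L. ?g (Suc L) (Suc k) * ?T k)"
    by (simp add: sum.atMost_Suc_shift del: sum.atMost_Suc gauss_binomial.simps(3))
  also have "\<dots> = (?U 0 + (\<Sum>k\<le>L. (x * y) ^ Suc k * ?g L (Suc k) * ?U (Suc k)))
      + (\<Sum>k\<le>L. ?g L k * ?T k)"
    by (simp add: gauss_binomial_Suc_Suc_alt algebra_simps sum.distrib del: gauss_binomial.simps(3))
  also have "?U 0 + (\<Sum>k\<le>L. (x * y) ^ Suc k * ?g L (Suc k) * ?U (Suc k))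
      = (\<Sum>k\<le>Suc L. (x * y) ^ k * ?g L k * ?U k)"
    by (simp add: sum.atMost_Suc_shift del: sum.atMost_Suc)
  also have "\<dots> = (\<Sum>k\<le>L. (x * y) ^ k * ?g L k * ?U k)"
    by (simp add: gauss_binomial_eq_0)
  also have "\<dots> = (\<Sum>k\<le>L. x ^ n * y ^ Suc n * (?g L k * ?T k))"
  proof (intro sum.cong refl)
    fix k
    have "(x * y) ^ k * ?g L k * ?U k = ((x * y) ^ k * ?U k) * ?g L k" by (simp only: mult_ac)
    also have "\<dots> = x ^ n * y ^ Suc n * (?g L k * ?T k)" 
      unfolding theta_term_lower by (simp only: mult_ac)
    finally show "(x * y) ^ k * ?g L k * ?U k = x ^ n * y ^ Suc n * (?g L k * ?T k)" .
  qed
  also have "\<dots> + (\<Sum>k\<le>L. ?g L k * ?T k)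
     = (\<Sum>k\<le>L. ?g L k * ?T k) * (1 + x ^ n * y ^ Suc n)"
    by (simp only: flip: sum_distrib_left) (simp add: algebra_simps)
  also have "(\<Sum>k\<le>L. ?g L k * ?T k) = (\<Prod>i<m. 1 + x ^ Suc i * y ^ i) * (\<Prod>i<n. 1 + x ^ i * y ^ Suc i)"
    unfolding L_def Suc.IH ..
  finally show ?case by (simp add: L_def algebra_simps)
qed

section \<open>The triple product modulo a power of the variable\<close>

definition agree_below :: "nat \<Rightarrow> 'a fps \<Rightarrow> 'a fps \<Rightarrow> bool" where
  "agree_below N f g \<longleftrightarrow> (\<forall>k<N. fps_nth f k = fps_nth g k)"

lemma agree_below_refl [simp]: "agree_below N f f"
  and agree_below_sym: "agree_below N f g \<Longrightarrow> agree_below N g f"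
  and agree_below_trans [trans]: "agree_below N f g \<Longrightarrow> agree_below N g h \<Longrightarrow> agree_below N f h"
  by (simp_all add: agree_below_def)

lemma agree_below_diff:
  fixes f g :: "'a::ring_1 fps"
  shows "agree_below N f f' \<Longrightarrow> agree_below N g g' \<Longrightarrow> agree_below N (f - g) (f' - g')"
  by (simp add: agree_below_def)

lemma agree_below_mult:
  fixes f g :: "'a::comm_ring_1 fps"
  shows "agree_below N f f' \<Longrightarrow> agree_below N g g' \<Longrightarrow> agree_below N (f * g) (f' * g')"
  by (auto simp: agree_below_def fps_mult_nth intro!: sum.cong)

lemma agree_below_sum:
  fixes f g :: "'b \<Rightarrow> 'a::comm_ring_1 fps"
  shows "(\<And>i. i \<in> I \<Longrightarrow> agree_below N (f i) (g i)) \<Longrightarrow> agree_below N (sum f I) (sum g I)"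
  by (simp add: agree_below_def fps_sum_nth)

lemma agree_below_prod:
  fixes f g :: "'b \<Rightarrow> 'a::comm_ring_1 fps"
  shows "(\<And>i. i \<in> I \<Longrightarrow> agree_below N (f i) (g i)) \<Longrightarrow> agree_below N (prod f I) (prod g I)"
  by (induction I rule: infinite_finite_induct) (auto intro: agree_below_mult)

lemma agree_below_inverse:
  fixes f g :: "'a::field fps"
  assumes "agree_below N f g" "fps_nth f 0 \<noteq> 0" "fps_nth g 0 \<noteq> 0"
  shows "agree_below N (inverse f) (inverse g)"
proof -
  have "agree_below N (inverse f * inverse g * g) (inverse f * inverse g * f)"
    using assms(1) by (intro agree_below_mult) (simp_all add: agree_below_sym)
  moreover have "inverse f * inverse g * g = inverse f" "inverse f * inverse g * f = inverse g"
    using assms inverse_mult_eq_1[of f] inverse_mult_eq_1[of g] by (simp_all add: algebra_simps)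
  ultimately show ?thesis by simp
qed

lemma agree_below_mult_X_power:
  fixes f :: "'a::comm_ring_1 fps"
  assumes "N \<le> e"
  shows "agree_below N (f * fps_X ^ e) 0"
  using assms by (simp add: agree_below_def fps_X_power_mult_right_nth)

text \<open>Factors that are 1 up to the bound may be added or dropped. This is what replaces the passage to
  an infinite product.\<close>

lemma agree_below_prod_superset:
  fixes f :: "'b \<Rightarrow> 'a::comm_ring_1 fps"
  assumes "finite B" "A \<subseteq> B" "\<And>i. i \<in> B - A \<Longrightarrow> agree_below N (f i) 1"
  shows "agree_below N (prod f A) (prod f B)"
proof -
  have "agree_below N (prod f (B - A) * prod f A) (prod (\<lambda>_. 1) (B - A) * prod f A)"
    using assms by (intro agree_below_mult agree_below_prod) auto
  then show ?thesis
    using prod.subset_diff[OF assms(2,1), of f] by (simp add: agree_below_sym)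
qed

lemma agree_below_sum_superset:
  fixes f :: "'b \<Rightarrow> 'a::comm_ring_1 fps"
  assumes "finite B" "A \<subseteq> B" "\<And>i. i \<in> B - A \<Longrightarrow> agree_below N (f i) 0"
  shows "agree_below N (sum f A) (sum f B)"
  using assms by (auto simp: agree_below_def fps_sum_nth intro!: sum.mono_neutral_left)

text \<open>The triple product is needed for monomials with a sign, since \<open>f(-q)\<close> arises from \<open>f(q)\<close> by
  negating both variables.\<close>

definition signed_monom :: "'a::comm_ring_1 \<Rightarrow> nat \<Rightarrow> 'a fps" where
  "signed_monom s a = fps_const s * fps_X ^ a"

lemma signed_monom_power: "signed_monom s a ^ k = signed_monom (s ^ k) (a * k)"
  by (simp add: signed_monom_def power_mult_distrib power_mult fps_const_power)

lemma signed_monom_mult: "signed_monom s a * signed_monom t b = signed_monom (s * t) (a + b)"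
  by (simp add: signed_monom_def power_add mult_ac flip: fps_const_mult)

lemma agree_below_signed_monom_0: "N \<le> e \<Longrightarrow> agree_below N (signed_monom s e) 0"
  unfolding signed_monom_def by (rule agree_below_mult_X_power)

lemma fps_nth_0_q_factorial:
  "0 < a \<Longrightarrow> fps_nth (q_factorial (signed_monom s a) n) 0 = 1"
  by (induction n) (auto simp: q_factorial_def signed_monom_power, auto simp: signed_monom_def)

lemma agree_below_q_factorial:
  assumes "0 < a" "N \<le> m" "m \<le> n"
  shows "agree_below N (q_factorial (signed_monom s a) m) (q_factorial (signed_monom s a) n)"
  unfolding q_factorial_def
proof (rule agree_below_prod_superset)
  fix i assume "i \<in> {..<n} - {..<m}"
  then have "N \<le> i" using assms by simp
  also have "i \<le> a * Suc i" using assms(1) by (cases a) auto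
  finally have "agree_below N (1 - signed_monom s a ^ Suc i) (1 - 0)"
    unfolding signed_monom_power
    by (intro agree_below_diff agree_below_signed_monom_0) auto
  then show "agree_below N (1 - signed_monom s a ^ Suc i) 1" by simp
qed (use assms in auto)

text \<open>In the limit \<open>m, k \<rightarrow> \<infinity>\<close> the Gaussian binomial tends to the inverse of the infinite product of
  \<open>1 - p^i\<close>: in the quotient formula the three factorials agree up to the bound, and one of them
  cancels.\<close>

lemma agree_below_gauss_binomial:
  fixes s :: "'a::field"
  assumes "0 < a" and "N \<le> m" and "N \<le> k" and "N \<le> n"
  defines "p \<equiv> signed_monom s a"
  shows "agree_below N (gauss_binomial p (m + k) k * q_factorial p n) 1"
proof -
  let ?Q = "q_factorial p n"
  have q: "agree_below N (q_factorial p l) ?Q" if "N \<le> l" for l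
    using agree_below_q_factorial[of a N l n s] agree_below_q_factorial[of a N n l s]
      assms that by (cases "l \<le> n") (auto simp: agree_below_sym)
  have u: "?Q * inverse ?Q = 1"
    unfolding p_def using assms(1) by (intro inverse_mult_eq_1') (simp add: fps_nth_0_q_factorial)
  have "agree_below N (gauss_binomial p (m + k) k * (?Q * ?Q))
      (gauss_binomial p (m + k) k * (q_factorial p m * q_factorial p k))"
    using assms by (intro agree_below_mult agree_below_sym[OF q]) auto
  also have "\<dots> = q_factorial p (m + k)"
    by (rule gauss_binomial_mult_q_factorial)
  also have "agree_below N \<dots> ?Q" using assms by (intro q) auto
  finally have "agree_below N (gauss_binomial p (m + k) k * (?Q * ?Q) * inverse ?Q) (?Q * inverse ?Q)"
    by (intro agree_below_mult) auto
  moreover have "gauss_binomial p (m + k) k * (?Q * ?Q) * inverse ?Q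
    = gauss_binomial p (m + k) k * ?Q * (?Q * inverse ?Q)"
    by (simp only: mult_ac)
  ultimately show ?thesis by (simp only: u mult_1_right)
qed

lemma theta_term_signed_monom:
  "theta_term (signed_monom s a) (signed_monom t b) j
    = signed_monom (s ^ triangle j * t ^ triangle (j - 1)) (a * triangle j + b * triangle (j - 1))"
  by (simp add: theta_term_def signed_monom_power signed_monom_mult)

text \<open>Only finitely many summands contribute to a given coefficient, because the exponents outgrow
  the index.\<close>

lemma abs_le_theta_exponent:
  assumes "0 < a" "0 < b"
  shows "nat \<bar>j\<bar> \<le> a * triangle j + b * triangle (j - 1)"
proof -
  have "\<bar>j\<bar> \<le> int (triangle j + triangle (j - 1))"
  proof -
    have "2 * int (triangle j + triangle (j - 1)) = 2 * (\<bar>j\<bar> * \<bar>j\<bar>)"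
      unfolding of_nat_add distrib_left int_triangle by (simp add: algebra_simps)
    then have "int (triangle j + triangle (j - 1)) = \<bar>j\<bar> * \<bar>j\<bar>" by simp
    moreover have "\<bar>j\<bar> * 1 \<le> \<bar>j\<bar> * \<bar>j\<bar>"
      by (cases "j = 0") (auto intro!: mult_left_mono simp del: abs_mult_self_eq)
    ultimately show ?thesis by (simp only: mult_1_right)
  qed
  moreover have "triangle j \<le> a * triangle j" "triangle (j - 1) \<le> b * triangle (j - 1)"
    using assms by auto
  ultimately show ?thesis by linarith
qed

text \<open>In the finite triple product, a summand with \<open>\<bar>j\<bar> \<ge> N\<close> vanishes below the bound, whatever its
  coefficient. For the others, \<open>n \<ge> 2 N\<close> leaves both entries of the Gaussian binomial at least \<open>N\<close>,
  so that its coefficient is cancelled by the factorial. The index set \<open>J\<close> is free, which lets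
  the even and odd indices be separated later without boundary terms.\<close>

theorem triple_product_agree_below:
  fixes s t :: "'a::field"
  assumes "0 < a" "0 < b" and n: "2 * N \<le> n" and J: "finite J" "{- int N..int N} \<subseteq> J"
  defines "x \<equiv> signed_monom s a" and "y \<equiv> signed_monom t b"
  shows "agree_below N
    (q_factorial (x * y) n * ((\<Prod>i<n. 1 + x ^ Suc i * y ^ i) * (\<Prod>i<n. 1 + x ^ i * y ^ Suc i)))
    (\<Sum>j\<in>J. theta_term x y j)"
proof -
  let ?g = "gauss_binomial (x * y) (n + n)" and ?Q = "q_factorial (x * y) n"
  have xy: "x * y = signed_monom (s * t) (a + b)" by (simp add: x_def y_def signed_monom_mult)
  have T0: "agree_below N (theta_term x y j) 0" if "int N \<le> \<bar>j\<bar>" for j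
    unfolding x_def y_def theta_term_signed_monom
    using abs_le_theta_exponent[OF assms(1,2), of j] that
    by (intro agree_below_signed_monom_0) auto
  have "?Q * ((\<Prod>i<n. 1 + x ^ Suc i * y ^ i) * (\<Prod>i<n. 1 + x ^ i * y ^ Suc i))
      = (\<Sum>k\<le>n + n. ?g k * ?Q * theta_term x y (int k - int n))"
    unfolding finite_triple_product sum_distrib_left by (simp only: mult_ac)
  also have "agree_below N \<dots> (\<Sum>k\<le>n + n. theta_term x y (int k - int n))"
  proof (rule agree_below_sum)
    fix k assume k: "k \<in> {..n + n}"
    show "agree_below N (?g k * ?Q * theta_term x y (int k - int n)) (theta_term x y (int k - int n))"
    proof (cases "int N \<le> \<bar>int k - int n\<bar>")
      case True
      have "agree_below N (?g k * ?Q * theta_term x y (int k - int n)) (?g k * ?Q * 0)"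
        by (intro agree_below_mult T0 True) auto
      also have "agree_below N (?g k * ?Q * 0) (theta_term x y (int k - int n))"
        using T0[OF True] by (simp add: agree_below_sym)
      finally show ?thesis .
    next
      case False
      have "agree_below N (?g k * ?Q) 1"
        using agree_below_gauss_binomial[of "a + b" N "n + n - k" k n "s * t"] False k n assms(1)
        by (simp add: xy)
      then have "agree_below N (?g k * ?Q * theta_term x y (int k - int n)) (1 * theta_term x y (int k - int n))"
        by (intro agree_below_mult) auto
      then show ?thesis by simp
    qed
  qed
  also have "(\<Sum>k\<le>n + n. theta_term x y (int k - int n)) = (\<Sum>j\<in>{- int n..int n}. theta_term x y j)"
    by (rule sum.reindex_bij_witness[of _ "\<lambda>j. nat (j + int n)" "\<lambda>k. int k - int n"]) auto
  also have "agree_below N \<dots> (\<Sum>j\<in>{- int n..int n} \<union> J. theta_term x y j)"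
    using J n by (intro agree_below_sum_superset T0) auto
  also have "agree_below N \<dots> (\<Sum>j\<in>J. theta_term x y j)"
  proof (rule agree_below_sym, rule agree_below_sum_superset)
    fix j assume "j \<in> {- int n..int n} \<union> J - J"
    with J(2) have "j \<notin> {- int N..int N}" by blast
    then show "agree_below N (theta_term x y j) 0" by (intro T0) auto
  qed (use J in auto)
  finally show ?thesis .
qed

section \<open>Generating functions of multisets\<close>

definition multisets_of_weight :: "('k \<Rightarrow> nat) \<Rightarrow> 'k set \<Rightarrow> nat \<Rightarrow> 'k multiset set" where
  "multisets_of_weight w K n = {P. set_mset P \<subseteq> K \<and> (\<Sum>k\<in>#P. w k) = n}"

text \<open>The generating function of the multiplicity of one part of size \<open>v\<close>, where \<open>c i\<close> is the weight of
  using the part \<open>i\<close> times.\<close>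

definition multiplicity_series :: "nat \<Rightarrow> (nat \<Rightarrow> 'a) \<Rightarrow> 'a::zero fps" where
  "multiplicity_series v c = Abs_fps (\<lambda>a. if v dvd a then c (a div v) else 0)"

text \<open>A multiset over \<open>insert k K\<close> is the multiplicity of \<open>k\<close> together with a multiset over \<open>K\<close>; this
  matches the Cauchy product with the series of \<open>k\<close>.\<close>

lemma bij_betw_multisets_of_weight_insert:
  assumes "k \<notin> K" "0 < w k"
  shows "bij_betw (\<lambda>(i, P). replicate_mset i k + P)
    (SIGMA i:{i. i * w k \<le> n}. multisets_of_weight w K (n - i * w k))
    (multisets_of_weight w (insert k K) n)"
proof (rule bij_betw_byWitness[where f' = "\<lambda>P. (count P k, filter_mset (\<lambda>l. l \<noteq> k) P)"])
  have [simp]: "count P k = 0" "filter_mset (\<lambda>l. l \<noteq> k) P = P" if "set_mset P \<subseteq> K" for P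
    using that assms(1) by (auto simp: not_in_iff[symmetric] filter_mset_eq_conv)
  show "\<forall>x\<in>SIGMA i:{i. i * w k \<le> n}. multisets_of_weight w K (n - i * w k).
     (count (case x of (i, P) \<Rightarrow> replicate_mset i k + P) k,
      filter_mset (\<lambda>l. l \<noteq> k) (case x of (i, P) \<Rightarrow> replicate_mset i k + P)) = x"
    by (auto simp: multisets_of_weight_def)
  have split: "replicate_mset (count P k) k + filter_mset (\<lambda>l. l \<noteq> k) P = P" for P
    using multiset_partition[of P "\<lambda>l. l = k"] by (simp add: filter_eq_replicate_mset)
  then show "\<forall>P\<in>multisets_of_weight w (insert k K) n.
     (case (count P k, filter_mset (\<lambda>l. l \<noteq> k) P) of (i, P) \<Rightarrow> replicate_mset i k + P) = P"
    by simp
  show "(\<lambda>(i, P). replicate_mset i k + P) `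
      (SIGMA i:{i. i * w k \<le> n}. multisets_of_weight w K (n - i * w k))
      \<subseteq> multisets_of_weight w (insert k K) n"
    by (auto simp: multisets_of_weight_def split: if_splits)
  show "(\<lambda>P. (count P k, filter_mset (\<lambda>l. l \<noteq> k) P)) ` multisets_of_weight w (insert k K) n
      \<subseteq> (SIGMA i:{i. i * w k \<le> n}. multisets_of_weight w K (n - i * w k))"
  proof (intro image_subsetI)
    fix P assume P: "P \<in> multisets_of_weight w (insert k K) n"
    have "(\<Sum>l\<in>#P. w l) = count P k * w k + (\<Sum>l\<in>#filter_mset (\<lambda>l. l \<noteq> k) P. w l)"
      by (subst split[of P, symmetric]) (simp del: split)
    then show "(count P k, filter_mset (\<lambda>l. l \<noteq> k) P)
        \<in> (SIGMA i:{i. i * w k \<le> n}. multisets_of_weight w K (n - i * w k))"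
      using P by (auto simp: multisets_of_weight_def)
  qed
qed

text \<open>Both counting problems are instances: unlimited parts have weights \<open>s ^ i\<close>, and overlined parts,
  which occur at most once, have the weight \<open>of_bool (i \<le> 1)\<close>.\<close>

theorem fps_nth_prod_multiplicity_series:
  fixes c :: "'k \<Rightarrow> nat \<Rightarrow> 'a::comm_ring_1"
  assumes "finite K" "\<And>k. k \<in> K \<Longrightarrow> 0 < w k"
  shows "finite (multisets_of_weight w K n)"
    and "fps_nth (\<Prod>k\<in>K. multiplicity_series (w k) (c k)) n
      = (\<Sum>P\<in>multisets_of_weight w K n. \<Prod>k\<in>K. c k (count P k))"
proof -
  have "finite (multisets_of_weight w K n) \<and>
    fps_nth (\<Prod>k\<in>K. multiplicity_series (w k) (c k)) n
      = (\<Sum>P\<in>multisets_of_weight w K n. \<Prod>k\<in>K. c k (count P k))"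
    using assms
  proof (induction K arbitrary: n)
    case empty
    have "multisets_of_weight w {} n = (if n = 0 then {{#}} else {})"
      by (auto simp: multisets_of_weight_def)
    then show ?case by simp
  next
    case (insert k K)
    let ?v = "w k" and ?G = "\<Prod>k\<in>K. multiplicity_series (w k) (c k)"
    let ?I = "{i. i * ?v \<le> n}" and ?M = "\<lambda>i. multisets_of_weight w K (n - i * ?v)"
    have v: "0 < ?v" using insert.prems by simp
    note bij = bij_betw_multisets_of_weight_insert[where w = w, OF insert.hyps(2) v]
    have "i \<le> n" if "i * ?v \<le> n" for i
      using that mult_le_mono2[of 1 ?v i] v by linarith
    then have I: "finite ?I" by (intro finite_subset[of ?I "{..n}"]) auto
    have IH: "finite (multisets_of_weight w K m)"
      "fps_nth ?G m = (\<Sum>P\<in>multisets_of_weight w K m. \<Prod>k\<in>K. c k (count P k))" for m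
      using insert.IH insert.prems by auto
    have "fps_nth (\<Prod>l\<in>insert k K. multiplicity_series (w l) (c l)) n
      = (\<Sum>a\<in>{0..n}. (if ?v dvd a then c k (a div ?v) else 0) * fps_nth ?G (n - a))"
      using insert.hyps by (simp add: fps_mult_nth multiplicity_series_def)
    also have "\<dots> = (\<Sum>a\<in>{a\<in>{0..n}. ?v dvd a}. c k (a div ?v) * fps_nth ?G (n - a))"
      by (intro sum.mono_neutral_cong_right) auto
    also have "\<dots> = (\<Sum>i\<in>?I. c k i * fps_nth ?G (n - i * ?v))"
      by (rule sum.reindex_bij_witness[of _ "\<lambda>i. i * ?v" "\<lambda>a. a div ?v"]) (use v in auto)
    also have "\<dots> = (\<Sum>i\<in>?I. \<Sum>P\<in>?M i. c k i * (\<Prod>l\<in>K. c l (count P l)))"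
      by (simp add: IH sum_distrib_left)
    also have "\<dots> = (\<Sum>(i, P)\<in>(SIGMA i:?I. ?M i). c k i * (\<Prod>l\<in>K. c l (count P l)))"
      using I IH by (intro sum.Sigma) auto
    also have "\<dots> = (\<Sum>(i, P)\<in>(SIGMA i:?I. ?M i).
        \<Prod>l\<in>insert k K. c l (count (replicate_mset i k + P) l))"
    proof (intro sum.cong refl, clarify)
      fix i P assume "P \<in> ?M i"
      then have "count P k = 0"
        using insert.hyps(2) by (auto simp: multisets_of_weight_def not_in_iff[symmetric])
      moreover have "(\<Prod>l\<in>K. c l (count (replicate_mset i k + P) l)) = (\<Prod>l\<in>K. c l (count P l))"
        using insert.hyps(2) by (intro prod.cong) auto
      ultimately show "c k i * (\<Prod>l\<in>K. c l (count P l))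
        = (\<Prod>l\<in>insert k K. c l (count (replicate_mset i k + P) l))"
        using insert.hyps by simp
    qed
    also have "\<dots> = (\<Sum>P\<in>multisets_of_weight w (insert k K) n. \<Prod>l\<in>insert k K. c l (count P l))"
      unfolding sum.reindex_bij_betw[OF bij, symmetric] by (simp add: case_prod_unfold)
    finally have "fps_nth (\<Prod>l\<in>insert k K. multiplicity_series (w l) (c l)) n = \<dots>" .
    moreover have "finite (multisets_of_weight w (insert k K) n)"
      using bij_betw_finite[OF bij, of n] I IH(1) by auto
    ultimately show ?case by blast
  qed
  then show "finite (multisets_of_weight w K n)"
    "fps_nth (\<Prod>k\<in>K. multiplicity_series (w k) (c k)) n
      = (\<Sum>P\<in>multisets_of_weight w K n. \<Prod>k\<in>K. c k (count P k))"
    by auto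
qed

lemma multiplicity_series_power:
  assumes "0 < v"
  shows "multiplicity_series v (\<lambda>i. s ^ i) = inverse (1 - fps_const (s :: 'a::field) * fps_X ^ v)"
proof -
  have "multiplicity_series v (\<lambda>i. s ^ i) * (1 - fps_const s * fps_X ^ v) = 1"
  proof (rule fps_ext)
    fix n
    have "fps_nth (multiplicity_series v (\<lambda>i. s ^ i) * (1 - fps_const s * fps_X ^ v)) n
      = fps_nth (multiplicity_series v (\<lambda>i. s ^ i)) n
        - fps_nth (fps_const s * multiplicity_series v (\<lambda>i. s ^ i) * fps_X ^ v) n"
      by (simp add: algebra_simps)
    also have "\<dots> = fps_nth 1 n"
      using assms
      by (auto simp: fps_X_power_mult_right_nth multiplicity_series_def dvd_minus_self le_div_geq
          elim!: dvdE) 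
    finally show "fps_nth (multiplicity_series v (\<lambda>i. s ^ i) * (1 - fps_const s * fps_X ^ v)) n
      = fps_nth 1 n" .
  qed
  then show ?thesis by (metis fps_inverse_unique mult.commute)
qed

lemma multiplicity_series_1:
  "0 < v \<Longrightarrow> multiplicity_series v (\<lambda>_. 1 :: 'a::field) = inverse (1 - fps_X ^ v)"
  using multiplicity_series_power[of v 1] by simp

lemma multiplicity_series_le_1:
  assumes "0 < v"
  shows "multiplicity_series v (\<lambda>i. of_bool (i \<le> 1)) = (1 + fps_X ^ v :: 'a::comm_ring_1 fps)"
proof (rule fps_ext)
  fix n
  show "fps_nth (multiplicity_series v (\<lambda>i. of_bool (i \<le> 1))) n = fps_nth (1 + fps_X ^ v :: 'a fps) n"
    using assms by (auto simp: multiplicity_series_def fps_X_power_nth le_Suc_eq elim!: dvdE)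
qed

section \<open>Odd powers in the product over odd parts\<close>

definition parts_upto :: "nat \<Rightarrow> (nat \<Rightarrow> bool) \<Rightarrow> nat set" where
  "parts_upto L p = {m \<in> {1..L}. p m}"

lemma finite_parts_upto [simp]: "finite (parts_upto L p)"
  by (simp add: parts_upto_def)

lemma prod_parts_upto_disj:
  assumes "\<And>m. m \<in> {1..L} \<Longrightarrow> r m \<longleftrightarrow> p m \<or> q m" "\<And>m. m \<in> {1..L} \<Longrightarrow> \<not> (p m \<and> q m)"
  shows "prod f (parts_upto L r) = prod f (parts_upto L p) * prod f (parts_upto L q)"
proof -
  have "parts_upto L r = parts_upto L p \<union> parts_upto L q"
    using assms(1) by (auto simp: parts_upto_def)
  moreover have "parts_upto L p \<inter> parts_upto L q = {}"
    using assms(2) by (auto simp: parts_upto_def)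
  ultimately show ?thesis by (simp add: prod.union_disjoint)
qed

lemma prod_arith_progression:
  assumes "0 < r" "r < c"
  shows "(\<Prod>i<n. f (c * i + r)) = prod f (parts_upto (c * n) (\<lambda>m. m mod c = r))"
proof (rule prod.reindex_bij_witness[of _ "\<lambda>m. m div c" "\<lambda>i. c * i + r"])
  fix i assume "i \<in> {..<n}"
  then have "c * Suc i \<le> c * n" by (intro mult_le_mono2) simp
  then show "c * i + r \<in> parts_upto (c * n) (\<lambda>m. m mod c = r)"
    using assms by (auto simp: parts_upto_def)
next
  fix m assume m: "m \<in> parts_upto (c * n) (\<lambda>m. m mod c = r)"
  have "m \<noteq> c * n" using m assms by (auto simp: parts_upto_def)
  then show "m div c \<in> {..<n}"
    using m assms by (auto simp: parts_upto_def less_mult_imp_div_less mult.commute)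
qed (use assms in \<open>auto simp: parts_upto_def\<close>)

lemma prod_multiples:
  assumes "0 < c"
  shows "(\<Prod>i<n. f (c * Suc i)) = prod f (parts_upto (c * n) (\<lambda>m. c dvd m))"
proof (rule prod.reindex_bij_witness[of _ "\<lambda>m. m div c - 1" "\<lambda>i. c * Suc i"])
  fix i assume "i \<in> {..<n}"
  then have "c * Suc i \<le> c * n" by (intro mult_le_mono2) simp
  then show "c * Suc i \<in> parts_upto (c * n) (\<lambda>m. c dvd m)"
    using assms by (auto simp: parts_upto_def)
next
  fix m assume "m \<in> parts_upto (c * n) (\<lambda>m. c dvd m)"
  then obtain k where "m = c * k" "0 < k" "k \<le> n"
    using assms by (auto simp: parts_upto_def elim!: dvdE)
  then show "c * Suc (m div c - 1) = m" "m div c - 1 \<in> {..<n}"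
    using assms by auto
qed (use assms in auto)

text \<open>The factors \<open>x^(i+1) y^i\<close> and \<open>x^i y^(i+1)\<close> of the triple product for \<open>x = s q^a\<close>, \<open>y = s q^b\<close> have
  the exponents that are congruent to \<open>a\<close> and \<open>b\<close> modulo \<open>a + b\<close>. The summand \<open>j\<close> carries the sign
  \<open>s^(j^2)\<close>.\<close>

lemma triple_product_parts:
  fixes s :: "'a::field"
  assumes ab: "0 < a" "0 < b" "a \<noteq> b" and s: "s * s = 1"
    and n: "2 * N \<le> n" and J: "finite J" "{- int N..int N} \<subseteq> J"
  defines "L \<equiv> (a + b) * n"
  shows "agree_below N
    ((\<Prod>m\<in>parts_upto L (\<lambda>m. (a + b) dvd m). 1 - fps_X ^ m)
      * (\<Prod>m\<in>parts_upto L (\<lambda>m. m mod (a + b) \<in> {a, b}). 1 + fps_const s * fps_X ^ m))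
    (\<Sum>j\<in>J. fps_const (if even j then 1 else s) * fps_X ^ (a * triangle j + b * triangle (j - 1)))"
proof -
  have s2: "s ^ (2 * k) = 1" for k by (simp add: power_mult s power2_eq_square)
  have odd: "s ^ (k + k) = 1" "s ^ Suc (k + k) = s" for k
    using s2[of k] by (simp_all add: mult_2)
  have 1: "q_factorial (signed_monom s a * signed_monom s b) n
      = (\<Prod>m\<in>parts_upto L (\<lambda>m. (a + b) dvd m). 1 - fps_X ^ m)"
    unfolding q_factorial_def signed_monom_mult signed_monom_power s L_def
    by (subst prod_multiples[symmetric]) (use ab in \<open>auto simp: signed_monom_def\<close>)
  have 2: "1 + signed_monom s a ^ Suc i * signed_monom s b ^ i
      = 1 + fps_const s * fps_X ^ ((a + b) * i + a)"
    "1 + signed_monom s a ^ i * signed_monom s b ^ Suc i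
      = 1 + fps_const s * fps_X ^ ((a + b) * i + b)" for i
    unfolding signed_monom_power signed_monom_mult power_add[symmetric] add_Suc add_Suc_right odd
    by (simp_all add: signed_monom_def algebra_simps)
  have 3: "(\<Prod>i<n. 1 + fps_const s * fps_X ^ ((a + b) * i + a)) * (\<Prod>i<n. 1 + fps_const s * fps_X ^ ((a + b) * i + b))
      = (\<Prod>m\<in>parts_upto L (\<lambda>m. m mod (a + b) \<in> {a, b}). 1 + fps_const s * fps_X ^ m)"
    unfolding L_def using ab
    by (subst (1 2) prod_arith_progression[where f = "\<lambda>m. 1 + fps_const s * fps_X ^ m"])
      (auto intro!: prod_parts_upto_disj[symmetric])
  have 4: "s ^ (triangle j + triangle (j - 1)) = (if even j then 1 else s)" for j
  proof -
    have "2 * int (triangle j + triangle (j - 1)) = 2 * (j * j)"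
      unfolding of_nat_add distrib_left int_triangle by (simp add: algebra_simps)
    then have "int (triangle j + triangle (j - 1)) = j * j" by simp
    then have "even (triangle j + triangle (j - 1)) \<longleftrightarrow> even j"
      by (metis even_mult_iff even_of_nat)
    then show ?thesis
      using odd(1,2)[of "(triangle j + triangle (j - 1)) div 2"]
      by (cases "even j") (auto simp flip: mult_2)
  qed
  show ?thesis
    using triple_product_agree_below[OF ab(1,2) n J, of s s]
    unfolding 1 2 3 theta_term_signed_monom power_add[symmetric] 4 by (simp only: signed_monom_def)
qed

text \<open>The exponent \<open>2 j^2 + j\<close> at \<open>j = 2 i - 1\<close> is \<open>1 + (8 i^2 - 6 i)\<close>, written with the triangular
  numbers of the two triple products.\<close>

lemma triangle_odd_index:
  "3 * triangle (2 * i - 1) + triangle (2 * i - 1 - 1) = Suc (2 * triangle i + 14 * triangle (i - 1))"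
proof -
  have "2 * int (3 * triangle (2 * i - 1) + triangle (2 * i - 1 - 1))
    = 3 * (2 * int (triangle (2 * i - 1))) + 2 * int (triangle (2 * i - 1 - 1))" by simp
  also have "\<dots> = 2 + 2 * (2 * int (triangle i)) + 14 * (2 * int (triangle (i - 1)))"
    unfolding int_triangle by (simp add: algebra_simps)
  finally have "2 * int (3 * triangle (2 * i - 1) + triangle (2 * i - 1 - 1))
     = 2 * int (Suc (2 * triangle i + 14 * triangle (i - 1)))" by simp
  then show ?thesis by (simp only: mult_cancel_left of_nat_eq_iff) simp
qed

text \<open>The triple product modulo 4 expands both products over odd parts; the terms with even index cancel
  in the difference, and those with odd index are summed by the triple product modulo 16.\<close>

lemma odd_product_difference:
  fixes N M :: nat
  assumes "2 * N \<le> M"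
  defines "L \<equiv> 16 * M"
  defines "O\<^sub>s \<equiv> \<lambda>s::real. \<Prod>m\<in>parts_upto L odd. 1 + fps_const s * fps_X ^ m"
  shows "agree_below N
    ((\<Prod>m\<in>parts_upto L (\<lambda>m. 4 dvd m). 1 - fps_X ^ m) * (O\<^sub>s 1 - O\<^sub>s (-1)))
    (2 * fps_X * ((\<Prod>m\<in>parts_upto L (\<lambda>m. 16 dvd m). 1 - fps_X ^ m)
      * (\<Prod>m\<in>parts_upto L (\<lambda>m. m mod 16 \<in> {2, 14}). 1 + fps_X ^ m)))"
proof -
  let ?E = "\<Prod>m\<in>parts_upto L (\<lambda>m. 4 dvd m). 1 - fps_X ^ m :: real fps"
  let ?e = "\<lambda>j. 3 * triangle j + triangle (j - 1)"
  (* The odd elements of J are exactly the numbers 2 i - 1 with i in I. *)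
  let ?J = "{- 2 * int N - 1..2 * int N + 1}" and ?I = "{- int N..int N + 1}"
  have odd: "parts_upto L (\<lambda>m. m mod 4 \<in> {3, 1}) = parts_upto L odd"
  proof -
    have "m mod 4 = 3 \<or> m mod 4 = 1 \<longleftrightarrow> odd m" for m :: nat by presburger
    then show ?thesis by (simp add: parts_upto_def)
  qed
  have A: "agree_below N (?E * O\<^sub>s s) (\<Sum>j\<in>?J. fps_const (if even j then 1 else s) * fps_X ^ ?e j)"
    if "s * s = 1" for s
    using triple_product_parts[of 3 1 s N "4 * M" ?J] that assms(1)
    unfolding L_def O\<^sub>s_def by (simp add: odd[unfolded L_def, simplified])
  have "agree_below N (?E * O\<^sub>s 1 - ?E * O\<^sub>s (-1))
     ((\<Sum>j\<in>?J. fps_const (if even j then 1 else 1) * fps_X ^ ?e j)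
      - (\<Sum>j\<in>?J. fps_const (if even j then 1 else - 1) * fps_X ^ ?e j))"
    by (intro agree_below_diff A) auto
  also have "\<dots> = (\<Sum>j\<in>?J. if even j then 0 else 2 * fps_X ^ ?e j)"
    unfolding sum_subtractf[symmetric]
    by (intro sum.cong refl) (simp add: fps_const_neg[symmetric] del: fps_const_neg)
  also have "\<dots> = (\<Sum>j\<in>{j \<in> ?J. odd j}. 2 * fps_X ^ ?e j)"
    by (intro sum.mono_neutral_cong_right) auto
  also have "\<dots> = (\<Sum>i\<in>?I. 2 * fps_X ^ ?e (2 * i - 1))"
    by (rule sum.reindex_bij_witness[of _ "\<lambda>i. 2 * i - 1" "\<lambda>j. (j + 1) div 2"])
      (auto elim!: oddE simp: add.commute)
  also have "\<dots> = 2 * fps_X * (\<Sum>i\<in>?I. fps_X ^ (2 * triangle i + 14 * triangle (i - 1)))"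
    unfolding triangle_odd_index by (simp add: sum_distrib_left mult_ac)
  also have "agree_below N \<dots> (2 * fps_X * ((\<Prod>m\<in>parts_upto L (\<lambda>m. 16 dvd m). 1 - fps_X ^ m)
      * (\<Prod>m\<in>parts_upto L (\<lambda>m. m mod 16 \<in> {2, 14}). 1 + fps_X ^ m)))"
    using triple_product_parts[of 2 14 1 N M ?I, THEN agree_below_sym] assms(1)
    unfolding L_def by (intro agree_below_mult agree_below_refl) simp
  finally show ?thesis by (simp add: algebra_simps)
qed

lemma fps_nth_0_prod_eq_1:
  fixes f :: "'b \<Rightarrow> 'a::comm_ring_1 fps"
  shows "(\<And>i. i \<in> I \<Longrightarrow> fps_nth (f i) 0 = 1) \<Longrightarrow> fps_nth (prod f I) 0 = 1"
  by (induction I rule: infinite_finite_induct) auto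

text \<open>The left-hand side is \<open>(f(q) - f(-q)) / (f(q) f(-q))\<close>. The factors \<open>1 - q^m\<close> with \<open>4 dvd m\<close>, introduced
  to apply the triple product, join the denominator \<open>f(q) f(-q)\<close> to form the product over all
  even parts, from which the multiples of 16 then cancel.\<close>

theorem odd_part_product_identity:
  fixes N M :: nat
  assumes "2 * N \<le> M"
  defines "L \<equiv> 16 * M"
  shows "agree_below N
    (inverse (\<Prod>m\<in>parts_upto L odd. 1 - fps_X ^ m) - inverse (\<Prod>m\<in>parts_upto L odd. 1 + fps_X ^ m))
    (2 * fps_X * ((\<Prod>m\<in>parts_upto L (\<lambda>m. m mod 16 \<in> {2, 14}). 1 + fps_X ^ m)
      * inverse (\<Prod>m\<in>parts_upto L (\<lambda>m. even m \<and> m mod 16 \<noteq> 0). 1 - fps_X ^ m :: real fps)))"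
proof -
  let ?P = "\<lambda>p. \<Prod>m\<in>parts_upto L p. 1 - fps_X ^ m :: real fps"
  let ?O = "\<Prod>m\<in>parts_upto L odd. 1 + fps_X ^ m :: real fps"
  let ?D = "\<Prod>m\<in>parts_upto L (\<lambda>m. m mod 16 \<in> {2, 14}). 1 + fps_X ^ m :: real fps"
  have P0: "fps_nth (?P p) 0 = 1" for p
    by (rule fps_nth_0_prod_eq_1) (auto simp: parts_upto_def)
  have O0: "fps_nth ?O 0 = 1"
    by (rule fps_nth_0_prod_eq_1) (auto simp: parts_upto_def)
  have P: "?P p * inverse (?P p) = 1" for p
    by (rule inverse_mult_eq_1') (simp add: P0)
  have O: "?O * inverse ?O = 1"
    by (rule inverse_mult_eq_1') (simp add: O0)
  have cancel: "a * b = (q * a) * (q' * b)" if "q * q' = 1" for a b q q' :: "real fps"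
  proof -
    have "(q * a) * (q' * b) = (q * q') * (a * b)" by (simp only: mult_ac)
    then show ?thesis using that by simp
  qed
  have even1: "?P even = ?P (\<lambda>m. 4 dvd m) * ?P (\<lambda>m. m mod 4 = 2)"
    by (rule prod_parts_upto_disj) presburger+
  have even2: "?P even = ?P (\<lambda>m. 16 dvd m) * ?P (\<lambda>m. even m \<and> m mod 16 \<noteq> 0)"
    by (rule prod_parts_upto_disj) presburger+
  have OP: "agree_below N (?O * ?P odd) (?P (\<lambda>m. m mod 4 = 2))"
  proof -
    have "?O * ?P odd = (\<Prod>m\<in>parts_upto L odd. 1 - fps_X ^ (2 * m))"
      unfolding prod.distrib[symmetric]
      by (intro prod.cong refl) (simp only: mult_2 power_add, simp add: algebra_simps)
    (* Doubling the odd parts up to L reaches up to 2 L; the surplus lies beyond the bound N. *)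
    also have "\<dots> = (\<Prod>m\<in>parts_upto (2 * L) (\<lambda>m. m mod 4 = 2). 1 - fps_X ^ m)"
      by (rule prod.reindex_bij_witness[of _ "\<lambda>m. m div 2" "\<lambda>m. 2 * m"])
        (auto simp: parts_upto_def; presburger)+
    also have "agree_below N (?P (\<lambda>m. m mod 4 = 2)) \<dots>"
    proof (rule agree_below_prod_superset)
      fix m assume "m \<in> parts_upto (2 * L) (\<lambda>m. m mod 4 = 2) - parts_upto L (\<lambda>m. m mod 4 = 2)"
      then have "N \<le> m" using assms(1) by (auto simp: parts_upto_def L_def)
      then have "agree_below N (1 - 1 * fps_X ^ m) (1 - 0 :: real fps)"
        by (intro agree_below_diff agree_below_refl agree_below_mult_X_power)
      then show "agree_below N (1 - fps_X ^ m) (1 :: real fps)" by simp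
    qed (auto simp: parts_upto_def)
    finally show ?thesis by (rule agree_below_sym)
  qed
  have num: "agree_below N (?P (\<lambda>m. 4 dvd m) * (?O - ?P odd)) (2 * fps_X * (?P (\<lambda>m. 16 dvd m) * ?D))"
    using odd_product_difference[OF assms(1)]
    by (simp add: L_def fps_const_neg[symmetric] del: fps_const_neg)
  have den: "agree_below N (inverse (?P (\<lambda>m. 4 dvd m)) * inverse (?O * ?P odd))
      (inverse (?P (\<lambda>m. 4 dvd m)) * inverse (?P (\<lambda>m. m mod 4 = 2)))"
    using OP P0 O0 by (intro agree_below_mult agree_below_inverse agree_below_refl) simp_all
  have "inverse (?P odd) - inverse ?O = (?O - ?P odd) * inverse (?O * ?P odd)"
    using O P[of odd] by (simp add: fps_inverse_mult algebra_simps)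
  then have lhs: "inverse (?P odd) - inverse ?O
      = (?P (\<lambda>m. 4 dvd m) * (?O - ?P odd)) * (inverse (?P (\<lambda>m. 4 dvd m)) * inverse (?O * ?P odd))"
    using cancel[OF P[of "\<lambda>m. 4 dvd m"]] by (rule trans)
  have "inverse (?P (\<lambda>m. even m \<and> m mod 16 \<noteq> 0)) = ?P (\<lambda>m. 16 dvd m) * inverse (?P even)"
    unfolding even2 fps_inverse_mult mult.assoc[symmetric] P by (rule mult_1_left[symmetric])
  also have "inverse (?P even) = inverse (?P (\<lambda>m. 4 dvd m)) * inverse (?P (\<lambda>m. m mod 4 = 2))"
    unfolding even1 by (rule fps_inverse_mult)
  finally have rhs: "2 * fps_X * (?D * inverse (?P (\<lambda>m. even m \<and> m mod 16 \<noteq> 0)))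
      = (2 * fps_X * (?P (\<lambda>m. 16 dvd m) * ?D))
        * (inverse (?P (\<lambda>m. 4 dvd m)) * inverse (?P (\<lambda>m. m mod 4 = 2)))"
    by (simp only: mult_ac)
  show ?thesis
    unfolding lhs rhs by (rule agree_below_mult[OF num den])
qed

section \<open>The two families of partitions\<close>

abbreviation weight_series :: "real \<Rightarrow> nat \<Rightarrow> real fps" where
  "weight_series s m \<equiv> inverse (1 - fps_const s * fps_X ^ m)"

definition F_kinds :: "nat \<Rightarrow> (nat \<times> color) set" where
  "F_kinds L = {(m, c). m \<in> {1..L} \<and> (even m \<longrightarrow> c = Blue)}"

lemma F_kinds_eq: "F_kinds L = (\<lambda>m. (m, Blue)) ` {1..L} \<union> (\<lambda>m. (m, Red)) ` parts_upto L odd"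
proof -
  have "(m, c) \<in> F_kinds L \<longleftrightarrow> (m, c) \<in> (\<lambda>m. (m, Blue)) ` {1..L} \<union> (\<lambda>m. (m, Red)) ` parts_upto L odd"
    for m c by (cases c) (simp_all add: F_kinds_def parts_upto_def image_iff)
  then show ?thesis by (intro equalityI subrelI) blast+
qed

lemma part_le_sum_mset:
  assumes "k \<in># P"
  shows "w k \<le> (\<Sum>l\<in>#P. w l :: nat)"
  using assms by (auto dest!: multi_member_split)

text \<open>No part exceeds the sum of all parts, so bounding the parts by \<open>L \<ge> n\<close> loses nothing.\<close>

lemma calF_eq:
  assumes "n \<le> L"
  shows "calF n = multisets_of_weight fst (F_kinds L) n"
proof -
  have "P \<in> calF n \<longleftrightarrow> P \<in> multisets_of_weight fst (F_kinds L) n" for P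
  proof (cases "(\<Sum>k\<in>#P. fst k) = n")
    case True
    then have "fst k \<le> L" if "k \<in># P" for k
      using part_le_sum_mset[OF that, of fst] assms by simp
    then have "set_mset P \<subseteq> F_kinds L
      \<longleftrightarrow> (\<forall>k\<in>#P. 0 < fst k) \<and> (\<forall>k\<in>#P. even (fst k) \<longrightarrow> snd k = Blue)"
      by (auto simp: F_kinds_def subset_iff Suc_le_eq)
    then show ?thesis
      using True
      by (simp add: calF_def two_color_partitions_def multisets_of_weight_def case_prod_unfold
          del: of_nat_sum_mset)
  next
    case False
    then show ?thesis
      by (simp add: calF_def two_color_partitions_def multisets_of_weight_def case_prod_unfold
          del: of_nat_sum_mset)
  qed
  then show ?thesis by blast
qed

lemma prod_mset_signs:
  "(\<Prod>k\<in>#P. if p k then -1 else 1 :: 'a::comm_ring_1) = (-1) ^ size (filter_mset p P)"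
  by (induction P) auto

text \<open>The sign \<open>s\<close> of a red odd part is 1 or -1; a partition then contributes 1 or -1 to the power of the
  number of its red odd parts, and the difference is 2 exactly if that number is odd.\<close>

lemma F1_coefficient:
  assumes "n \<le> L"
  shows "2 * real (F1 n) = fps_nth
    ((inverse (\<Prod>m\<in>parts_upto L odd. 1 - fps_X ^ m) - inverse (\<Prod>m\<in>parts_upto L odd. 1 + fps_X ^ m))
      * inverse (\<Prod>m\<in>{1..L}. 1 - fps_X ^ m)) n"
proof -
  let ?K = "F_kinds L" and ?red = "\<lambda>(m, c). odd m \<and> c = Red"
  let ?size = "\<lambda>P. size (filter_mset ?red P)"
  define sgn where "sgn = (\<lambda>s::real. \<lambda>k::nat \<times> color. if ?red k then s else 1)"
  have fin: "finite ?K" by (auto simp: F_kinds_eq)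
  have pos: "0 < fst k" if "k \<in> ?K" for k using that by (auto simp: F_kinds_def)
  have P: "inverse (\<Prod>m\<in>parts_upto L odd. 1 - fps_const s * fps_X ^ m) * inverse (\<Prod>m\<in>{1..L}. 1 - fps_X ^ m)
      = (\<Prod>k\<in>?K. multiplicity_series (fst k) (\<lambda>i. sgn s k ^ i))" for s
  proof -
    have "(\<Prod>k\<in>?K. multiplicity_series (fst k) (\<lambda>i. sgn s k ^ i))
      = (\<Prod>k\<in>?K. weight_series (sgn s k) (fst k))"
      using pos by (intro prod.cong refl multiplicity_series_power)
    also have "\<dots> = (\<Prod>m\<in>{1..L}. weight_series (sgn s (m, Blue)) m) * (\<Prod>m\<in>parts_upto L odd. weight_series (sgn s (m, Red)) m)"
      unfolding F_kinds_eq
      by (subst prod.union_disjoint) (auto simp: prod.reindex inj_on_def)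
    also have "(\<Prod>m\<in>{1..L}. weight_series (sgn s (m, Blue)) m) = inverse (\<Prod>m\<in>{1..L}. 1 - fps_X ^ m)"
      by (simp add: sgn_def inverse_prod_fps)
    also have "(\<Prod>m\<in>parts_upto L odd. weight_series (sgn s (m, Red)) m)
      = inverse (\<Prod>m\<in>parts_upto L odd. 1 - fps_const s * fps_X ^ m)"
      unfolding inverse_prod_fps by (intro prod.cong) (auto simp: sgn_def parts_upto_def)
    finally show ?thesis by (simp only: mult_ac)
  qed
  have C: "fps_nth (inverse (\<Prod>m\<in>parts_upto L odd. 1 - fps_const s * fps_X ^ m) * inverse (\<Prod>m\<in>{1..L}. 1 - fps_X ^ m)) n
    = (\<Sum>P\<in>calF n. \<Prod>k\<in>#P. sgn s k)" for s
  proof -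
    have "(\<Prod>k\<in>?K. sgn s k ^ count P k) = (\<Prod>k\<in>#P. sgn s k)" if "P \<in> calF n" for P
    proof -
      have "set_mset P \<subseteq> ?K" using that by (simp add: calF_eq[OF assms] multisets_of_weight_def)
      then show ?thesis
        unfolding image_prod_mset_multiplicity
        using fin by (intro prod.mono_neutral_right) (auto simp: not_in_iff)
    qed
    then show ?thesis
      unfolding P calF_eq[OF assms]
      by (subst fps_nth_prod_multiplicity_series(2)[where w = fst, OF fin pos]) (auto intro!: sum.cong)
  qed
  have finF: "finite (calF n)"
    unfolding calF_eq[OF assms] by (rule fps_nth_prod_multiplicity_series(1)[where w = fst, OF fin pos])
  have "fps_nth ((inverse (\<Prod>m\<in>parts_upto L odd. 1 - fps_X ^ m) - inverse (\<Prod>m\<in>parts_upto L odd. 1 + fps_X ^ m))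
      * inverse (\<Prod>m\<in>{1..L}. 1 - fps_X ^ m)) n
    = (\<Sum>P\<in>calF n. (\<Prod>k\<in>#P. sgn 1 k)) - (\<Sum>P\<in>calF n. (\<Prod>k\<in>#P. sgn (-1) k))"
    unfolding C[symmetric] by (simp add: left_diff_distrib fps_const_neg[symmetric] del: fps_const_neg)
  also have "\<dots> = (\<Sum>P\<in>calF n. if odd (?size P) then 2 else 0)"
    unfolding sum_subtractf[symmetric] sgn_def prod_mset_signs
    by (intro sum.cong refl) simp
  also have "\<dots> = 2 * real (card {P \<in> calF n. odd (?size P)})"
    using finF by (simp add: sum.If_cases Int_def)
  finally show ?thesis by (simp add: F1_def)
qed

text \<open>An overlined copy counts as a part of its own kind, so that the overlining condition becomes a bound
  on multiplicities.\<close>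

definition R_kinds :: "nat \<Rightarrow> (nat \<times> color \<times> bool) set" where
  "R_kinds L = {(m, c, b). m \<in> {1..L} \<and> (b \<longrightarrow> c = Blue \<and> m mod 16 \<in> {2, 14})
     \<and> (odd m \<or> m mod 16 = 0 \<longrightarrow> c = Blue)}"

lemma R_kinds_eq:
  "R_kinds L = (\<lambda>m. (m, Blue, False)) ` {1..L}
    \<union> ((\<lambda>m. (m, Red, False)) ` parts_upto L (\<lambda>m. even m \<and> m mod 16 \<noteq> 0)
    \<union> (\<lambda>m. (m, Blue, True)) ` parts_upto L (\<lambda>m. m mod 16 \<in> {2, 14}))"
  (is "_ = ?S")
proof -
  have "(m, c, b) \<in> R_kinds L \<longleftrightarrow> (m, c, b) \<in> ?S" for m c b
    by (cases c; cases b) (auto simp: R_kinds_def parts_upto_def image_iff)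
  then show ?thesis by (intro set_eqI) (simp add: split_paired_all)
qed

lemma restricted_overlined_partitions_eq:
  assumes "n \<le> L"
  shows "restricted_overlined_partitions (int n)
    = {P \<in> multisets_of_weight fst (R_kinds L) n. \<forall>k\<in>R_kinds L. snd (snd k) \<longrightarrow> count P k \<le> 1}"
    (is "?A = ?B")
proof -
  have le: "fst k \<le> n" if "k \<in># P" "(\<Sum>k\<in>#P. fst k) = n" for k :: "nat \<times> color \<times> bool" and P
    using part_le_sum_mset[OF that(1), of fst] that(2) by simp
  have A: "P \<in> ?A \<longleftrightarrow> (\<forall>k\<in>#P. 0 < fst k) \<and> (\<Sum>k\<in>#P. fst k) = n
      \<and> (\<forall>(m, c, b)\<in>#P. b \<longrightarrow> c = Blue \<and> m mod 16 \<in> {2, 14}) \<and> (\<forall>m. count P (m, Blue, True) \<le> 1)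
      \<and> (\<forall>(m, c, b)\<in>#P. odd m \<or> m mod 16 = 0 \<longrightarrow> c = Blue)" for P
    by (auto simp: restricted_overlined_partitions_def overlined_two_color_partitions_def
        two_color_partitions_def multiset.map_comp comp_def case_prod_unfold
        simp del: of_nat_sum_mset)
  have B: "P \<in> ?B \<longleftrightarrow> (\<forall>k\<in>#P. k \<in> R_kinds L) \<and> (\<Sum>k\<in>#P. fst k) = n
      \<and> (\<forall>k\<in>R_kinds L. snd (snd k) \<longrightarrow> count P k \<le> 1)" for P
    by (auto simp: multisets_of_weight_def)
  have "P \<in> ?A \<longleftrightarrow> P \<in> ?B" for P
  proof (cases "(\<Sum>k\<in>#P. fst k) = n")
    case True
    then have "fst k \<le> L" if "k \<in># P" for k using le[OF that] assms by simp
    then have kinds: "(\<forall>k\<in>#P. k \<in> R_kinds L) \<longleftrightarrow> (\<forall>k\<in>#P. 0 < fst k)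
        \<and> (\<forall>(m, c, b)\<in>#P. b \<longrightarrow> c = Blue \<and> m mod 16 \<in> {2, 14})
        \<and> (\<forall>(m, c, b)\<in>#P. odd m \<or> m mod 16 = 0 \<longrightarrow> c = Blue)"
      by (simp add: R_kinds_def case_prod_unfold Suc_le_eq ball_conj_distrib conj_ac)
    have "count P (m, Blue, True) \<le> 1"
      if "\<forall>k\<in>#P. k \<in> R_kinds L" "\<forall>k\<in>R_kinds L. snd (snd k) \<longrightarrow> count P k \<le> 1" for m
    proof (cases "(m, Blue, True) \<in># P")
      case True
      with that(1) have "(m, Blue, True) \<in> R_kinds L" by blast
      with that(2) show ?thesis by fastforce
    next
      case False
      then show ?thesis by (simp add: not_in_iff)
    qed
    moreover have "count P k \<le> 1"
      if le: "\<forall>m. count P (m, Blue, True) \<le> 1" and k: "k \<in> R_kinds L" "snd (snd k)" for k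
    proof -
      obtain m where "k = (m, Blue, True)" using k by (auto simp: R_kinds_def)
      then show ?thesis using le by simp
    qed
    ultimately have once: "(\<forall>k\<in>#P. k \<in> R_kinds L) \<longrightarrow>
        ((\<forall>k\<in>R_kinds L. snd (snd k) \<longrightarrow> count P k \<le> 1)
          \<longleftrightarrow> (\<forall>m. count P (m, Blue, True) \<le> 1))"
      by blast
    show ?thesis unfolding A B using kinds True once by argo
  next
    case False
    then show ?thesis unfolding A B by blast
  qed
  then show ?thesis by blast
qed

lemma restricted_overlined_partitions_coefficient:
  assumes "n \<le> L"
  shows "real (card (restricted_overlined_partitions (int n))) = fps_nth
    ((\<Prod>m\<in>parts_upto L (\<lambda>m. m mod 16 \<in> {2, 14}). 1 + fps_X ^ m)
      * inverse (\<Prod>m\<in>parts_upto L (\<lambda>m. even m \<and> m mod 16 \<noteq> 0). 1 - fps_X ^ m)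
      * inverse (\<Prod>m\<in>{1..L}. 1 - fps_X ^ m)) n"
proof -
  let ?K = "R_kinds L" and ?M = "multisets_of_weight fst (R_kinds L) n"
  define c where "c = (\<lambda>k::nat \<times> color \<times> bool. \<lambda>i::nat. if snd (snd k) then of_bool (i \<le> 1) else 1 :: real)"
  have c: "c (m, x, True) = (\<lambda>i. of_bool (i \<le> 1))" "c (m, x, False) = (\<lambda>_. 1)" for m x
    by (simp_all add: c_def)
  have fin: "finite ?K" by (auto simp: R_kinds_eq)
  have pos: "0 < fst k" if "k \<in> ?K" for k using that by (auto simp: R_kinds_def)
  have "(\<Prod>k\<in>?K. multiplicity_series (fst k) (c k))
    = (\<Prod>m\<in>{1..L}. multiplicity_series m (\<lambda>_. 1))
      * ((\<Prod>m\<in>parts_upto L (\<lambda>m. even m \<and> m mod 16 \<noteq> 0). multiplicity_series m (\<lambda>_. 1))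
      * (\<Prod>m\<in>parts_upto L (\<lambda>m. m mod 16 \<in> {2, 14}). multiplicity_series m (\<lambda>i. of_bool (i \<le> 1))))"
    unfolding R_kinds_eq
    by (subst prod.union_disjoint, simp, simp, force, subst prod.union_disjoint)
      (auto simp: prod.reindex inj_on_def c)
  also have "(\<Prod>m\<in>{1..L}. multiplicity_series m (\<lambda>_. 1)) = inverse (\<Prod>m\<in>{1..L}. 1 - fps_X ^ m :: real fps)"
    unfolding inverse_prod_fps
    by (intro prod.cong refl, subst multiplicity_series_1) auto
  also have "(\<Prod>m\<in>parts_upto L (\<lambda>m. even m \<and> m mod 16 \<noteq> 0). multiplicity_series m (\<lambda>_. 1))
      = inverse (\<Prod>m\<in>parts_upto L (\<lambda>m. even m \<and> m mod 16 \<noteq> 0). 1 - fps_X ^ m :: real fps)"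
    unfolding inverse_prod_fps
    by (intro prod.cong refl, subst multiplicity_series_1) (auto simp: parts_upto_def)
  also have "(\<Prod>m\<in>parts_upto L (\<lambda>m. m mod 16 \<in> {2, 14}). multiplicity_series m (\<lambda>i. of_bool (i \<le> 1)))
      = (\<Prod>m\<in>parts_upto L (\<lambda>m. m mod 16 \<in> {2, 14}). 1 + fps_X ^ m :: real fps)"
    by (intro prod.cong refl multiplicity_series_le_1) (auto simp: parts_upto_def)
  finally have "fps_nth ((\<Prod>m\<in>parts_upto L (\<lambda>m. m mod 16 \<in> {2, 14}). 1 + fps_X ^ m)
      * inverse (\<Prod>m\<in>parts_upto L (\<lambda>m. even m \<and> m mod 16 \<noteq> 0). 1 - fps_X ^ m)
      * inverse (\<Prod>m\<in>{1..L}. 1 - fps_X ^ m)) n = fps_nth (\<Prod>k\<in>?K. multiplicity_series (fst k) (c k)) n"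
    by (simp only: mult_ac)
  also have "\<dots> = (\<Sum>P\<in>?M. \<Prod>k\<in>?K. c k (count P k))"
    by (rule fps_nth_prod_multiplicity_series(2)[where w = fst, OF fin pos])
  also have "\<dots> = (\<Sum>P\<in>?M. of_bool (\<forall>k\<in>?K. snd (snd k) \<longrightarrow> count P k \<le> 1))"
  proof (intro sum.cong refl)
    fix P
    show "(\<Prod>k\<in>?K. c k (count P k)) = of_bool (\<forall>k\<in>?K. snd (snd k) \<longrightarrow> count P k \<le> 1)"
    proof (cases "\<forall>k\<in>?K. snd (snd k) \<longrightarrow> count P k \<le> 1")
      case True
      then have "(\<Prod>k\<in>?K. c k (count P k)) = 1" by (intro prod.neutral) (simp add: c_def)
      then show ?thesis using True by simp
    next
      case False
      then have "(\<Prod>k\<in>?K. c k (count P k)) = 0" using fin by (auto simp: prod_zero_iff c_def)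
      then show ?thesis using False by simp
    qed
  qed
  also have "\<dots> = real (card (restricted_overlined_partitions (int n)))"
    unfolding restricted_overlined_partitions_eq[OF assms]
    using fps_nth_prod_multiplicity_series(1)[where w = fst, OF fin pos]
    by (simp add: of_bool_def sum.If_cases Int_def)
  finally show ?thesis ..
qed

theorem corollary2:
  fixes n :: nat
  shows "F1 n = card (restricted_overlined_partitions (int n - 1))"
proof -
  define N where "N = Suc n"
  (* Coefficient n is below the bound N, and the triple product needs 2 N factors of each kind. *)
  define L where "L = 16 * (2 * N)"
  have n: "n \<le> L" "n - 1 \<le> L" by (simp_all add: L_def N_def)
  let ?R = "(\<Prod>m\<in>parts_upto L (\<lambda>m. m mod 16 \<in> {2, 14}). 1 + fps_X ^ m)
      * inverse (\<Prod>m\<in>parts_upto L (\<lambda>m. even m \<and> m mod 16 \<noteq> 0). 1 - fps_X ^ m)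
      * inverse (\<Prod>m\<in>{1..L}. 1 - fps_X ^ m) :: real fps"
  have "agree_below N
    ((inverse (\<Prod>m\<in>parts_upto L odd. 1 - fps_X ^ m) - inverse (\<Prod>m\<in>parts_upto L odd. 1 + fps_X ^ m))
      * inverse (\<Prod>m\<in>{1..L}. 1 - fps_X ^ m)) (fps_X * (2 * ?R))"
    using agree_below_mult[OF odd_part_product_identity[of N "2 * N"] agree_below_refl,
        of "inverse (\<Prod>m\<in>{1..L}. 1 - fps_X ^ m)"]
    by (simp add: L_def mult_ac)
  then have "2 * real (F1 n) = fps_nth (fps_X * (2 * ?R)) n"
    unfolding F1_coefficient[OF n(1)] by (simp add: agree_below_def N_def)
  also have "\<dots> = 2 * real (card (restricted_overlined_partitions (int n - 1)))"
  proof (cases n)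
    case 0
    have "int m \<noteq> - 1" for m by linarith
    then have "two_color_partitions (- 1) = {}"
      by (simp add: two_color_partitions_def del: of_nat_sum_mset)
    then have "restricted_overlined_partitions (- 1) = {}"
      by (simp add: restricted_overlined_partitions_def overlined_two_color_partitions_def)
    then show ?thesis using 0 by simp
  next
    case (Suc k)
    have "fps_nth (fps_X * (2 * ?R)) n = 2 * fps_nth ?R k"
      using Suc by (simp add: numeral_fps_const)
    also have "fps_nth ?R k = real (card (restricted_overlined_partitions (int k)))"
      using restricted_overlined_partitions_coefficient[of k L] n Suc by simp
    finally show ?thesis using Suc by simp
  qed
  finally show ?thesis by simp
qed

end
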